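(* Let $(T,\dashv,\vdash,\perp,\alpha,\beta)$ be a multiplicative BiHom-associative trialgebra over a field $\mathbb{F}$ and let $(V,\alpha_V,\beta_V)$ be a BiHom-module of $T$. Let $F$ and $G$ be two cohomologous 2-cocycles on $T$ with values in $V$, and let $T_F$ and $T_G$ be the respective central extensions of $V$ by $T$ that they define. Then $T_F$ and $T_G$ are equivalent extensions. In particular, a central extension $T_B$ defined by a 2-coboundary $B$ is equivalent to a trivial central extension.
   Context: Everything is over a field $\mathbb{F}$. A BiHom-associative trialgebra $(T,\dashv,\vdash,\perp,\alpha,\beta)$ is a vector space $T$ with linear maps $\dashv,\vdash,\perp:T\otimes T\to T$ and $\alpha,\beta:T\to T$ (the structure maps) such that $\alpha\circ\beta=\beta\circ\alpha$ and, for all $x,y,z\in T$: (1) $(x\dashv y)\dashv\beta(z)=\alpha(x)\dashv(y\dashv z)$; (2) $(x\dashv y)\dashv\beta(z)=\alpha(x)\dashv(y\vdash z)$; (3) $(x\vdash y)\dashv\beta(z)=\alpha(x)\vdash(y\dashv z)$; (4) $(x\dashv y)\vdash\beta(z)=\alpha(x)\vdash(y\vdash z)$; (5) $(x\vdash y)\vdash\beta(z)=\alpha(x)\vdash(y\vdash z)$; (6) $(x\dashv y)\dashv\beta(z)=\alpha(x)\dashv(y\perp z)$; (7) $(x\perp y)\dashv\beta(z)=\alpha(x)\perp(y\dashv z)$; (8) $(x\dashv y)\perp\beta(z)=\alpha(x)\perp(y\vdash z)$; (9) $(x\vdash y)\perp\beta(z)=\alpha(x)\vdash(y\perp z)$;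 (10) $(x\perp y)\vdash\beta(z)=\alpha(x)\vdash(y\vdash z)$; (11) $(x\perp y)\perp\beta(z)=\alpha(x)\perp(y\perp z)$. A homomorphism $\phi:(T_1,\dashv_1,\vdash_1,\perp_1,\alpha_1,\beta_1)\to(T_2,\dashv_2,\vdash_2,\perp_2,\alpha_2,\beta_2)$ is a linear map with $\phi(x\ast_1 y)=\phi(x)\ast_2\phi(y)$ for each $\ast\in\{\dashv,\vdash,\perp\}$, $\alpha_2\circ\phi=\phi\circ\alpha_1$ and $\beta_2\circ\phi=\phi\circ\beta_1$; an isomorphism is a bijective homomorphism. $T$ is multiplicative if $\alpha$ and $\beta$ are homomorphisms $T\to T$. A BiHom-module $(V,\alpha_V,\beta_V)$ is a vector space $V$ with linear maps $\alpha_V,\beta_V:V\to V$ satisfying $\alpha_V\circ\beta_V=\beta_V\circ\alpha_V$. It is a BiHom-module of $T$ if there are six linear maps $\dashv,\vdash,\perp:T\otimes V\to V$ and $\dashv,\vdash,\perp:V\otimes T\to V$ satisfying the 33 axioms obtained from identities (1)–(11) by taking exactly one of $x,y,z$ in $V$ and the other two in $T$ (with $\alpha_V,\beta_V$ in place of $\alpha,\beta$ on elements of $V$), and such that $\alpha_V(x\ast v)=\alpha(x)\ast\alpha_V(v)$, $\beta_V(x\ast v)=\beta(x)\ast\beta_V(v)$, $\alpha_V(v\ast x)=\alpha_V(v)\ast\alpha(x)$, $\beta_V(v\ast x)=\beta_V(v)\ast\beta(x)$ for $x\in T$, $v\in V$, $\ast\in\{\dashv,\vdash,\perp\}$. A 2-cocycle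 on $T$ with values in $V$ is a triple $F$ of bilinear maps $f_{\dashv},f_{\vdash},f_{\perp}:T\times T\to V$ such that, for all $x,y,z\in T$ and $\ast\in\{\vdash,\dashv,\perp\}$: $f_\ast(\alpha(x),\alpha(y))=\alpha_V(f_\ast(x,y))$, $f_\ast(\beta(x),\beta(y))=\beta_V(f_\ast(x,y))$, and $f_{\dashv}(x\dashv y,\beta(z))=f_{\dashv}(\alpha(x),y\dashv z)$; $f_{\dashv}(x\dashv y,\beta(z))=f_{\dashv}(\alpha(x),y\vdash z)$; $f_{\dashv}(x\vdash y,\beta(z))=f_{\vdash}(\alpha(x),y\dashv z)$; $f_{\vdash}(x\dashv y,\beta(z))=f_{\vdash}(\alpha(x),y\vdash z)$; $f_{\vdash}(x\vdash y,\beta(z))=f_{\vdash}(\alpha(x),y\vdash z)$; $f_{\dashv}(x\dashv y,\beta(z))=f_{\dashv}(\alpha(x),y\perp z)$; $f_{\dashv}(x\perp y,\beta(z))=f_{\perp}(\alpha(x),y\dashv z)$; $f_{\perp}(x\dashv y,\beta(z))=f_{\perp}(\alpha(x),y\vdash z)$; $f_{\perp}(x\vdash y,\beta(z))=f_{\vdash}(\alpha(x),y\perp z)$; $f_{\vdash}(x\perp y,\beta(z))=f_{\vdash}(\alpha(x),y\vdash z)$; $f_{\perp}(x\perp y,\beta(z))=f_{\perp}(\alpha(x),y\perp z)$. 2-cocycles form a vector space under componentwise operations. A 2-coboundary is a 2-cocycle $B=(b_{\dashv},b_{\vdash},b_{\perp})$ of the form $b_{\ast}(x,y)=\mu(x\ast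 y)$ for each $\ast\in\{\dashv,\vdash,\perp\}$, where $\mu:T\to V$ is a morphism of BiHom-modules $(T,\alpha,\beta)\to(V,\alpha_V,\beta_V)$, i.e. a linear map with $\mu\circ\alpha=\alpha_V\circ\mu$ and $\mu\circ\beta=\beta_V\circ\mu$. Two 2-cocycles $F,G$ are cohomologous if $F-G$ is a 2-coboundary. For a 2-cocycle $F$, $T_F$ denotes the vector space $T\oplus V$ with operations $(x+u)\triangleleft(y+v)=x\dashv y+f_{\dashv}(x,y)$, $(x+u)\triangleright(y+v)=x\vdash y+f_{\vdash}(x,y)$, $(x+u)\diamond(y+v)=x\perp y+f_{\perp}(x,y)$ (in the roles of $\dashv,\vdash,\perp$) and structure maps $(\alpha\oplus\alpha_V)(x+u)=\alpha(x)+\alpha_V(u)$, $(\beta\oplus\beta_V)(x+u)=\beta(x)+\beta_V(u)$; it is a multiplicative BiHom-associative trialgebra. Regarding $V$ as an abelian BiHom-associative trialgebra (all three products zero, structure maps $\alpha_V,\beta_V$), $T_F$ is a central extension $0\to V\xrightarrow{\iota}T_F\xrightarrow{\pi}T\to0$ of $V$ by $T$, with $\iota$ the inclusion and $\pi(x+u)=x$. Extensions: an extension of $M$ by $T$ is an exact sequence $0\to M\xrightarrow{\iota}K\xrightarrow{\pi}T\to0$ of homomorphisms of BiHom-associative trialgebras. It is central if $\ker(\pi)\subseteq Z(K)$, where $Z(K)$ is the set of $z\in K$ with $z\ast t=t\ast z=0$ for all $t\in K$ and all three products $\ast$. It is trivial if there is an ideal $I$ of $K$ with $K=\ker(\pi)\oplus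 I$, where an ideal is a subspace stable under the structure maps and under left and right multiplication (for all three products) by arbitrary elements of $K$. Two extensions $0\to M\xrightarrow{\iota_1}K_1\xrightarrow{\pi_1}T\to0$ and $0\to M\xrightarrow{\iota_2}K_2\xrightarrow{\pi_2}T\to0$ are equivalent if there is an isomorphism $\phi:K_1\to K_2$ with $\phi\circ\iota_1=\iota_2$ and $\pi_2\circ\phi=\pi_1$. *)

theory Defs
  imports "HOL-Analysis.Product_Vector"
begin

text \<open>
  Vector spaces are given by a type of vectors together with a scalar multiplication.
  The three products are indexed by \<open>trialg_op\<close>; \<open>Dashv\<close>, \<open>Vdash\<close>, \<open>Perp\<close>
  stand for $\dashv$, $\vdash$, $\perp$.
\<close>

datatype trialg_op = Dashv | Vdash | Perp

record ('f, 'a) bihom_space =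
  smul :: "'f \<Rightarrow> 'a \<Rightarrow> 'a"
  alpha :: "'a \<Rightarrow> 'a"
  beta :: "'a \<Rightarrow> 'a"

record ('f, 'a) bihom_trialg = "('f, 'a) bihom_space" +
  mul :: "trialg_op \<Rightarrow> 'a \<Rightarrow> 'a \<Rightarrow> 'a"

abbreviation vlinear ::
  "('f::field, 'a::ab_group_add, 'm) bihom_space_scheme \<Rightarrow>
   ('f, 'b::ab_group_add, 'n) bihom_space_scheme \<Rightarrow> ('a \<Rightarrow> 'b) \<Rightarrow> bool" where
  "vlinear A B f \<equiv> Vector_Spaces.linear (smul A) (smul B) f"

definition vbilinear ::
  "('f::field, 'a::ab_group_add, 'm) bihom_space_scheme \<Rightarrow>
   ('f, 'b::ab_group_add, 'n) bihom_space_scheme \<Rightarrow>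
   ('f, 'c::ab_group_add, 'k) bihom_space_scheme \<Rightarrow> ('a \<Rightarrow> 'b \<Rightarrow> 'c) \<Rightarrow> bool" where
  "vbilinear A B C f \<longleftrightarrow>
     (\<forall>x. vlinear B C (\<lambda>y. f x y)) \<and> (\<forall>y. vlinear A C (\<lambda>x. f x y))"

definition bihom_module ::
  "('f::field, 'a::ab_group_add, 'm) bihom_space_scheme \<Rightarrow> bool" where
  "bihom_module V \<longleftrightarrow>
     vector_space (smul V) \<and> vlinear V V (alpha V) \<and> vlinear V V (beta V) \<and>
     alpha V \<circ> beta V = beta V \<circ> alpha V"

definition bihom_module_hom ::
  "('f::field, 'a::ab_group_add, 'm) bihom_space_scheme \<Rightarrow>
   ('f, 'b::ab_group_add, 'n) bihom_space_scheme \<Rightarrow> ('a \<Rightarrow> 'b) \<Rightarrow> bool" where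
  "bihom_module_hom A B \<mu> \<longleftrightarrow>
     vlinear A B \<mu> \<and> \<mu> \<circ> alpha A = alpha B \<circ> \<mu> \<and> \<mu> \<circ> beta A = beta B \<circ> \<mu>"

text \<open>
  All defining identities have the shape
  $(x \ast_p y) \ast_q \beta(z) = \alpha(x) \ast_r (y \ast_s z)$;
  the tuple \<open>(p, q, r, s)\<close> encodes this identity.
\<close>

definition trialg_identities ::
  "(trialg_op \<times> trialg_op \<times> trialg_op \<times> trialg_op) set" where
  "trialg_identities =
    {(Dashv, Dashv, Dashv, Dashv),
     (Dashv, Dashv, Dashv, Vdash),
     (Vdash, Dashv, Vdash, Dashv),
     (Dashv, Vdash, Vdash, Vdash),
     (Vdash, Vdash, Vdash, Vdash),
     (Dashv, Dashv, Dashv, Perp),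
     (Perp, Dashv, Perp, Dashv),
     (Dashv, Perp, Perp, Vdash),
     (Vdash, Perp, Vdash, Perp),
     (Perp, Vdash, Vdash, Vdash),
     (Perp, Perp, Perp, Perp)}"

definition bihom_trialgebra :: "('f::field, 'a::ab_group_add) bihom_trialg \<Rightarrow> bool" where
  "bihom_trialgebra T \<longleftrightarrow>
     bihom_module T \<and>
     (\<forall>p. vbilinear T T T (mul T p)) \<and>
     (\<forall>(p, q, r, s) \<in> trialg_identities. \<forall>x y z.
        mul T q (mul T p x y) (beta T z) = mul T r (alpha T x) (mul T s y z))"

definition trialg_hom ::
  "('f::field, 'a::ab_group_add) bihom_trialg \<Rightarrow> ('f, 'b::ab_group_add) bihom_trialg \<Rightarrow>
   ('a \<Rightarrow> 'b) \<Rightarrow> bool" where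
  "trialg_hom A B \<phi> \<longleftrightarrow>
     vlinear A B \<phi> \<and>
     (\<forall>p x y. \<phi> (mul A p x y) = mul B p (\<phi> x) (\<phi> y)) \<and>
     alpha B \<circ> \<phi> = \<phi> \<circ> alpha A \<and> beta B \<circ> \<phi> = \<phi> \<circ> beta A"

definition trialg_iso ::
  "('f::field, 'a::ab_group_add) bihom_trialg \<Rightarrow> ('f, 'b::ab_group_add) bihom_trialg \<Rightarrow>
   ('a \<Rightarrow> 'b) \<Rightarrow> bool" where
  "trialg_iso A B \<phi> \<longleftrightarrow> trialg_hom A B \<phi> \<and> bij \<phi>"

definition multiplicative :: "('f::field, 'a::ab_group_add) bihom_trialg \<Rightarrow> bool" where
  "multiplicative T \<longleftrightarrow> trialg_hom T T (alpha T) \<and> trialg_hom T T (beta T)"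

text \<open>
  The three identities quantified over \<open>v\<close> below are the instances of an identity of \<open>T\<close> whose
  first, second and third argument, respectively, is taken from \<open>V\<close>. The maps \<open>l p\<close> and \<open>r p\<close> are
  the left and right actions $T \otimes V \to V$ and $V \otimes T \to V$.
\<close>

definition bihom_module_of ::
  "('f::field, 'a::ab_group_add) bihom_trialg \<Rightarrow> ('f, 'v::ab_group_add) bihom_space \<Rightarrow>
   (trialg_op \<Rightarrow> 'a \<Rightarrow> 'v \<Rightarrow> 'v) \<Rightarrow> (trialg_op \<Rightarrow> 'v \<Rightarrow> 'a \<Rightarrow> 'v) \<Rightarrow> bool" where
  "bihom_module_of T V l r \<longleftrightarrow>
     bihom_module V \<and>
     (\<forall>p. vbilinear T V V (l p)) \<and> (\<forall>p. vbilinear V T V (r p)) \<and>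
     (\<forall>(p, q, p', q') \<in> trialg_identities.
        (\<forall>v y z. r q (r p v y) (beta T z) = r p' (alpha V v) (mul T q' y z)) \<and>
        (\<forall>x v z. r q (l p x v) (beta T z) = l p' (alpha T x) (r q' v z)) \<and>
        (\<forall>x y v. l q (mul T p x y) (beta V v) = l p' (alpha T x) (l q' y v))) \<and>
     (\<forall>p x v.
        alpha V (l p x v) = l p (alpha T x) (alpha V v) \<and>
        beta V (l p x v) = l p (beta T x) (beta V v) \<and>
        alpha V (r p v x) = r p (alpha V v) (alpha T x) \<and>
        beta V (r p v x) = r p (beta V v) (beta T x))"

definition two_cocycle ::
  "('f::field, 'a::ab_group_add) bihom_trialg \<Rightarrow> ('f, 'v::ab_group_add) bihom_space \<Rightarrow>
   (trialg_op \<Rightarrow> 'a \<Rightarrow> 'a \<Rightarrow> 'v) \<Rightarrow> bool" where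
  "two_cocycle T V F \<longleftrightarrow>
     (\<forall>p. vbilinear T T V (F p)) \<and>
     (\<forall>p x y. F p (alpha T x) (alpha T y) = alpha V (F p x y)) \<and>
     (\<forall>p x y. F p (beta T x) (beta T y) = beta V (F p x y)) \<and>
     (\<forall>(p, q, r, s) \<in> trialg_identities. \<forall>x y z.
        F q (mul T p x y) (beta T z) = F r (alpha T x) (mul T s y z))"

definition two_coboundary ::
  "('f::field, 'a::ab_group_add) bihom_trialg \<Rightarrow> ('f, 'v::ab_group_add) bihom_space \<Rightarrow>
   (trialg_op \<Rightarrow> 'a \<Rightarrow> 'a \<Rightarrow> 'v) \<Rightarrow> bool" where
  "two_coboundary T V B \<longleftrightarrow>
     two_cocycle T V B \<and>
     (\<exists>\<mu>. bihom_module_hom T V \<mu> \<and> (\<forall>p x y. B p x y = \<mu> (mul T p x y)))"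

definition cohomologous ::
  "('f::field, 'a::ab_group_add) bihom_trialg \<Rightarrow> ('f, 'v::ab_group_add) bihom_space \<Rightarrow>
   (trialg_op \<Rightarrow> 'a \<Rightarrow> 'a \<Rightarrow> 'v) \<Rightarrow> (trialg_op \<Rightarrow> 'a \<Rightarrow> 'a \<Rightarrow> 'v) \<Rightarrow> bool" where
  "cohomologous T V F G \<longleftrightarrow> two_coboundary T V (\<lambda>p x y. F p x y - G p x y)"

definition abelian_trialg :: "('f, 'v::ab_group_add) bihom_space \<Rightarrow> ('f, 'v) bihom_trialg" where
  "abelian_trialg V = \<lparr>smul = smul V, alpha = alpha V, beta = beta V, mul = (\<lambda>p u v. 0)\<rparr>"

text \<open>
  The direct sum $T \oplus V$ is the product type, so that \<open>(x, u)\<close> is $x + u$; the inclusion of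
  \<open>V\<close> is \<open>Pair 0\<close> and the projection onto \<open>T\<close> is \<open>fst\<close>.
\<close>

definition cocycle_trialg ::
  "('f::field, 'a::ab_group_add) bihom_trialg \<Rightarrow> ('f, 'v::ab_group_add) bihom_space \<Rightarrow>
   (trialg_op \<Rightarrow> 'a \<Rightarrow> 'a \<Rightarrow> 'v) \<Rightarrow> ('f, 'a \<times> 'v) bihom_trialg" where
  "cocycle_trialg T V F =
     \<lparr>smul = module_prod.scale (smul T) (smul V),
      alpha = map_prod (alpha T) (alpha V),
      beta = map_prod (beta T) (beta V),
      mul = (\<lambda>p (x, u) (y, v). (mul T p x y, F p x y))\<rparr>"

definition hom_kernel :: "('a \<Rightarrow> 'b::zero) \<Rightarrow> 'a set" where
  "hom_kernel f = {x. f x = 0}"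

definition trialg_center :: "('f, 'a::ab_group_add) bihom_trialg \<Rightarrow> 'a set" where
  "trialg_center K = {z. \<forall>p t. mul K p z t = 0 \<and> mul K p t z = 0}"

definition trialg_ideal :: "('f::field, 'a::ab_group_add) bihom_trialg \<Rightarrow> 'a set \<Rightarrow> bool" where
  "trialg_ideal K I \<longleftrightarrow>
     module.subspace (smul K) I \<and>
     (\<forall>a\<in>I. alpha K a \<in> I \<and> beta K a \<in> I) \<and>
     (\<forall>p. \<forall>a\<in>I. \<forall>t. mul K p a t \<in> I \<and> mul K p t a \<in> I)"

definition extension ::
  "('f::field, 'm::ab_group_add) bihom_trialg \<Rightarrow> ('m \<Rightarrow> 'k) \<Rightarrow>
   ('f, 'k::ab_group_add) bihom_trialg \<Rightarrow> ('k \<Rightarrow> 't) \<Rightarrow>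
   ('f, 't::ab_group_add) bihom_trialg \<Rightarrow> bool" where
  "extension M \<iota> K \<pi> T \<longleftrightarrow>
     bihom_trialgebra M \<and> bihom_trialgebra K \<and> bihom_trialgebra T \<and>
     trialg_hom M K \<iota> \<and> trialg_hom K T \<pi> \<and>
     inj \<iota> \<and> range \<iota> = hom_kernel \<pi> \<and> surj \<pi>"

definition central_extension ::
  "('f::field, 'm::ab_group_add) bihom_trialg \<Rightarrow> ('m \<Rightarrow> 'k) \<Rightarrow>
   ('f, 'k::ab_group_add) bihom_trialg \<Rightarrow> ('k \<Rightarrow> 't) \<Rightarrow>
   ('f, 't::ab_group_add) bihom_trialg \<Rightarrow> bool" where
  "central_extension M \<iota> K \<pi> T \<longleftrightarrow> extension M \<iota> K \<pi> T \<and> hom_kernel \<pi> \<subseteq> trialg_center K"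

definition trivial_extension ::
  "('f::field, 'm::ab_group_add) bihom_trialg \<Rightarrow> ('m \<Rightarrow> 'k) \<Rightarrow>
   ('f, 'k::ab_group_add) bihom_trialg \<Rightarrow> ('k \<Rightarrow> 't) \<Rightarrow>
   ('f, 't::ab_group_add) bihom_trialg \<Rightarrow> bool" where
  "trivial_extension M \<iota> K \<pi> T \<longleftrightarrow>
     extension M \<iota> K \<pi> T \<and>
     (\<exists>I. trialg_ideal K I \<and> hom_kernel \<pi> \<inter> I = {0} \<and>
          {a + b | a b. a \<in> hom_kernel \<pi> \<and> b \<in> I} = UNIV)"

definition equivalent_extensions ::
  "('f::field, 'm::ab_group_add) bihom_trialg \<Rightarrow> ('f, 't::ab_group_add) bihom_trialg \<Rightarrow>
   ('m \<Rightarrow> 'k1) \<Rightarrow> ('f, 'k1::ab_group_add) bihom_trialg \<Rightarrow> ('k1 \<Rightarrow> 't) \<Rightarrow>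
   ('m \<Rightarrow> 'k2) \<Rightarrow> ('f, 'k2::ab_group_add) bihom_trialg \<Rightarrow> ('k2 \<Rightarrow> 't) \<Rightarrow> bool" where
  "equivalent_extensions M T \<iota>1 K1 \<pi>1 \<iota>2 K2 \<pi>2 \<longleftrightarrow>
     extension M \<iota>1 K1 \<pi>1 T \<and> extension M \<iota>2 K2 \<pi>2 T \<and>
     (\<exists>\<phi>. trialg_iso K1 K2 \<phi> \<and> \<phi> \<circ> \<iota>1 = \<iota>2 \<and> \<pi>2 \<circ> \<phi> = \<pi>1)"

lemma linear_conv:
  "Vector_Spaces.linear s1 s2 f \<longleftrightarrow> vector_space s1 \<and> vector_space s2 \<and>
     (\<forall>x y. f (x + y) = f x + f y) \<and> (\<forall>c x. f (s1 c x) = s2 c (f x))"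
  by (auto simp: module_hom_iff_linear[symmetric] module_hom_def module_hom_axioms_def
      module_iff_vector_space)

lemma vlinear_0: "vlinear A B f \<Longrightarrow> f 0 = 0"
  unfolding module_hom_iff_linear[symmetric] by (rule module_hom.zero)

lemma vbilinear_0:
  assumes "vbilinear A B C f"
  shows "f 0 y = 0" "f x 0 = 0"
  using assms vlinear_0[of A C "\<lambda>x. f x y"] vlinear_0[of B C "f x"]
  by (auto simp: vbilinear_def)

lemma bihom_trialgebra_abelian:
  assumes "bihom_module V"
  shows "bihom_trialgebra (abelian_trialg V)"
proof -
  have "vector_space (smul V)"
    using assms by (simp add: bihom_module_def)
  then interpret vector_space "smul V" .
  show ?thesis
    using assms
    by (auto simp: bihom_trialgebra_def bihom_module_def vbilinear_def abelian_trialg_def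
        linear_conv)
qed

text \<open>Cocycle extensions are central extensions, so the notions of extension apply to them.\<close>

lemma central_extension_cocycle:
  assumes T: "bihom_trialgebra T" and V: "bihom_module V" and F: "two_cocycle T V F"
  shows "central_extension (abelian_trialg V) (Pair 0) (cocycle_trialg T V F) fst T"
proof -
  have vT: "vector_space (smul T)" and vV: "vector_space (smul V)"
    using T V by (auto simp: bihom_trialgebra_def bihom_module_def)
  interpret P: vector_space_prod "smul T" "smul V"
    using vT vV by (simp add: vector_space_prod_def vector_space_pair_def)
  have prod: "vector_space (module_prod.scale (smul T) (smul V))"
    by (rule P.p.vector_space_axioms)
  have "bihom_module (cocycle_trialg T V F)"
    using T V prod
    by (simp add: bihom_trialgebra_def bihom_module_def cocycle_trialg_def linear_conv
        P.scale_def fun_eq_iff)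
  moreover have "vbilinear (cocycle_trialg T V F) (cocycle_trialg T V F)
      (cocycle_trialg T V F) (mul (cocycle_trialg T V F) p)" for p
  proof -
    have "vbilinear T T T (mul T p)" and "vbilinear T T V (F p)"
      using T F by (simp_all add: bihom_trialgebra_def two_cocycle_def)
    then show ?thesis
      using prod by (simp add: vbilinear_def cocycle_trialg_def linear_conv P.scale_def
          split_beta)
  qed
  moreover have "mul T q (mul T p x y) (beta T z) = mul T r (alpha T x) (mul T s y z)"
    and "F q (mul T p x y) (beta T z) = F r (alpha T x) (mul T s y z)"
    if "(p, q, r, s) \<in> trialg_identities" for p q r s x y z
    using T F that unfolding bihom_trialgebra_def two_cocycle_def by fastforce+
  ultimately have K: "bihom_trialgebra (cocycle_trialg T V F)"
    unfolding bihom_trialgebra_def by (auto simp: cocycle_trialg_def)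
  have zero: "mul T p 0 x = 0" "mul T p x 0 = 0" "F p 0 x = 0" "F p x 0 = 0" for p x
    using T F vbilinear_0[of T T T "mul T p"] vbilinear_0[of T T V "F p"]
    by (auto simp: bihom_trialgebra_def two_cocycle_def)
  have zero': "alpha T 0 = 0" "beta T 0 = 0"
    using T by (auto simp: bihom_trialgebra_def bihom_module_def dest: vlinear_0)
  have \<iota>: "trialg_hom (abelian_trialg V) (cocycle_trialg T V F) (Pair 0)"
    using vT vV prod
    by (auto simp: trialg_hom_def cocycle_trialg_def abelian_trialg_def linear_conv P.scale_def
        zero zero' fun_eq_iff zero_prod_def)
  have \<pi>: "trialg_hom (cocycle_trialg T V F) T fst"
    using vT vV prod
    by (auto simp: trialg_hom_def cocycle_trialg_def linear_conv P.scale_def fun_eq_iff)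
  have "hom_kernel fst \<subseteq> trialg_center (cocycle_trialg T V F)"
    by (auto simp: hom_kernel_def trialg_center_def cocycle_trialg_def zero zero_prod_def)
  then show ?thesis
    using T K \<iota> \<pi> bihom_trialgebra_abelian[OF V]
    by (auto simp: central_extension_def extension_def inj_def hom_kernel_def)
qed

lemma multiplicative_cocycle:
  assumes "bihom_trialgebra T" "multiplicative T" "bihom_module V" "two_cocycle T V F"
  shows "multiplicative (cocycle_trialg T V F)"
proof -
  interpret P: vector_space_prod "smul T" "smul V"
    using assms
    by (simp add: bihom_trialgebra_def bihom_module_def vector_space_prod_def vector_space_pair_def)
  have prod: "vector_space (module_prod.scale (smul T) (smul V))"
    by (rule P.p.vector_space_axioms)
  have "bihom_module T"
    using assms by (simp add: bihom_trialgebra_def)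
  then show ?thesis
    using assms(2-4) prod
    by (simp add: multiplicative_def trialg_hom_def bihom_module_def two_cocycle_def
        cocycle_trialg_def linear_conv P.scale_def fun_eq_iff)
qed

end

theory Submission
  imports Defs
begin

text \<open>
  If \<open>F - G\<close> is the coboundary of \<open>\<mu>\<close>, then the shear $x + u \mapsto x + (u - \mu(x))$ is an
  equivalence $T_F \to T_G$. A coboundary is cohomologous to the zero cocycle, and in \<open>T\<^sub>0\<close> the
  summand \<open>T\<close> is an ideal complementary to \<open>V\<close>.
\<close>

lemma cohomologous_equivalent_extensions:
  assumes T: "bihom_trialgebra T" and V: "bihom_module V"
    and F: "two_cocycle T V F" and G: "two_cocycle T V G"
    and FG: "cohomologous T V F G"
  shows "equivalent_extensions (abelian_trialg V) T
           (Pair 0) (cocycle_trialg T V F) fst (Pair 0) (cocycle_trialg T V G) fst"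
proof -
  obtain \<mu> where \<mu>: "bihom_module_hom T V \<mu>"
    and diff: "F p x y - G p x y = \<mu> (mul T p x y)" for p x y
    using FG by (auto simp: cohomologous_def two_coboundary_def)
  define \<phi> where "\<phi> = (\<lambda>(x, u). (x, u - \<mu> x))"
  have vT: "vector_space (smul T)" and vV: "vector_space (smul V)"
    using T V by (auto simp: bihom_trialgebra_def bihom_module_def)
  interpret P: vector_space_prod "smul T" "smul V"
    using vT vV by (simp add: vector_space_prod_def vector_space_pair_def)
  have prod: "vector_space (module_prod.scale (smul T) (smul V))"
    by (rule P.p.vector_space_axioms)
  have \<mu>_lin: "\<mu> (x + y) = \<mu> x + \<mu> y" "\<mu> (smul T c x) = smul V c (\<mu> x)"
    and \<mu>_comm: "\<mu> (alpha T x) = alpha V (\<mu> x)" "\<mu> (beta T x) = beta V (\<mu> x)" for c x y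
    using \<mu> by (simp_all add: bihom_module_hom_def linear_conv fun_eq_iff)
  have lin: "vlinear V V (alpha V)" "vlinear V V (beta V)"
    using V by (simp_all add: bihom_module_def)
  \<comment> \<open>The second component of \<open>\<phi>\<close> is a difference, so commuting with
    the structure maps needs them to distribute over subtraction; \<open>\<mu>_comm\<close> then
    moves them past \<open>\<mu>\<close>.\<close>
  have lin_diff: "alpha V (u - w) = alpha V u - alpha V w"
    "beta V (u - w) = beta V u - beta V w" for u w
    using lin[folded module_hom_iff_linear] by (simp_all add: module_hom.diff)
  \<comment> \<open>This makes the shear fix every element of the included copy of
    \<open>V\<close>.\<close>
  have \<mu>0: "\<mu> 0 = 0"
    using \<mu> by (auto simp: bihom_module_hom_def dest: vlinear_0)
  \<comment> \<open>This is the multiplicativity of \<open>\<phi>\<close>. Products in a cocycle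
    extension ignore the \<open>V\<close>-components of their factors, so shearing the factors has
    no effect on the product, and the shear of the product turns its \<open>F\<close>-term into the
    \<open>G\<close>-term.\<close>
  have G_eq: "F p x y - \<mu> (mul T p x y) = G p x y" for p x y
    by (simp flip: diff)
  have "trialg_hom (cocycle_trialg T V F) (cocycle_trialg T V G) \<phi>"
    using prod
    by (auto simp: trialg_hom_def cocycle_trialg_def linear_conv P.scale_def \<phi>_def
        fun_eq_iff \<mu>_lin \<mu>_comm lin_diff G_eq
        module.scale_right_diff_distrib[OF vV[folded module_iff_vector_space]])
  moreover have "bij \<phi>"
    by (rule bij_betw_byWitness[where f' = "\<lambda>(x, u). (x, u + \<mu> x)"]) (auto simp: \<phi>_def)
  ultimately have "trialg_iso (cocycle_trialg T V F) (cocycle_trialg T V G) \<phi>"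
    by (simp add: trialg_iso_def)
  moreover have "\<phi> \<circ> Pair 0 = Pair 0" "fst \<circ> \<phi> = fst"
    by (auto simp: \<phi>_def fun_eq_iff \<mu>0)
  ultimately show ?thesis
    using central_extension_cocycle[OF T V F] central_extension_cocycle[OF T V G]
    by (auto simp: equivalent_extensions_def central_extension_def)
qed

text \<open>The zero cocycle defines the direct sum of \<open>T\<close> and the abelian trialgebra
  \<open>V\<close>, the model to which coboundary extensions are compared.\<close>

lemma two_cocycle_zero:
  assumes "bihom_trialgebra T" "bihom_module V"
  shows "two_cocycle T V (\<lambda>p x y. 0)"
proof -
  have V: "vector_space (smul V)" "vlinear V V (alpha V)" "vlinear V V (beta V)"
    using assms by (auto simp: bihom_module_def)
  interpret vector_space "smul V"
    by (rule V(1))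
  show ?thesis
    using assms vlinear_0[OF V(2)] vlinear_0[OF V(3)]
    by (auto simp: two_cocycle_def vbilinear_def linear_conv bihom_trialgebra_def
        bihom_module_def)
qed

lemma trivial_extension_zero_cocycle:
  fixes T :: "('f::field, 'a::ab_group_add) bihom_trialg"
    and V :: "('f, 'v::ab_group_add) bihom_space"
  assumes T: "bihom_trialgebra T" and V: "bihom_module V"
  shows "trivial_extension (abelian_trialg V) (Pair 0) (cocycle_trialg T V (\<lambda>p x y. 0)) fst T"
proof -
  let ?K = "cocycle_trialg T V (\<lambda>p x y. 0)" and ?I = "range (\<lambda>x. (x, 0)) :: ('a \<times> 'v) set"
  have vT: "vector_space (smul T)" and vV: "vector_space (smul V)"
    using T V by (auto simp: bihom_trialgebra_def bihom_module_def)
  interpret P: vector_space_prod "smul T" "smul V"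
    using vT vV by (simp add: vector_space_prod_def vector_space_pair_def)
  \<comment> \<open>These keep \<open>?I\<close> stable under the structure maps. It absorbs
    products on either side because with zero cocycle every product has \<open>V\<close>-component
    zero.\<close>
  have "alpha V 0 = 0" "beta V 0 = 0"
    using V by (auto simp: bihom_module_def dest: vlinear_0)
  moreover have "module.subspace (smul ?K) ?I"
    by (auto simp: cocycle_trialg_def P.p.subspace_def P.scale_def zero_prod_def)
  ultimately have "trialg_ideal ?K ?I"
    by (auto simp: trialg_ideal_def cocycle_trialg_def)
  moreover have "hom_kernel fst \<inter> ?I = {0}"
    by (auto simp: hom_kernel_def zero_prod_def)
  moreover have "{a + b | a b. a \<in> hom_kernel fst \<and> b \<in> ?I} = (UNIV :: ('a \<times> 'v) set)"
  proof -
    have "\<exists>a b. z = a + b \<and> a \<in> hom_kernel fst \<and> b \<in> ?I" for z :: "'a \<times> 'v"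
      by (rule exI[of _ "(0, snd z)"], rule exI[of _ "(fst z, 0)"]) (simp add: hom_kernel_def)
    then show ?thesis
      by blast
  qed
  moreover have "extension (abelian_trialg V) (Pair 0) ?K fst T"
    using central_extension_cocycle[OF T V two_cocycle_zero[OF T V]]
    by (simp add: central_extension_def)
  ultimately show ?thesis
    unfolding trivial_extension_def by blast
qed

theorem corollary3p5:
  fixes T :: "('f::field, 'a::ab_group_add) bihom_trialg"
    and V :: "('f, 'v::ab_group_add) bihom_space"
    and l :: "trialg_op \<Rightarrow> 'a \<Rightarrow> 'v \<Rightarrow> 'v"
    and r :: "trialg_op \<Rightarrow> 'v \<Rightarrow> 'a \<Rightarrow> 'v"
    and F G :: "trialg_op \<Rightarrow> 'a \<Rightarrow> 'a \<Rightarrow> 'v"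
  assumes "bihom_trialgebra T" and "multiplicative T"
    and "bihom_module_of T V l r"
    and "two_cocycle T V F" and "two_cocycle T V G"
    and "cohomologous T V F G"
  shows "equivalent_extensions (abelian_trialg V) T
           (Pair 0) (cocycle_trialg T V F) fst (Pair 0) (cocycle_trialg T V G) fst \<and>
         (\<forall>B. two_coboundary T V B \<longrightarrow>
           (\<exists>\<iota> (K :: ('f, 'a \<times> 'v) bihom_trialg) \<pi>.
              central_extension (abelian_trialg V) \<iota> K \<pi> T \<and>
              trivial_extension (abelian_trialg V) \<iota> K \<pi> T \<and>
              equivalent_extensions (abelian_trialg V) T
                (Pair 0) (cocycle_trialg T V B) fst \<iota> K \<pi>))"
proof (intro conjI allI impI)
  have V: "bihom_module V"
    using assms(3) by (simp add: bihom_module_of_def)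
  show "equivalent_extensions (abelian_trialg V) T
      (Pair 0) (cocycle_trialg T V F) fst (Pair 0) (cocycle_trialg T V G) fst"
    using assms V by (intro cohomologous_equivalent_extensions)
  fix B
  assume B: "two_coboundary T V B"
  \<comment> \<open>Subtracting the zero cocycle leaves \<open>B\<close> itself, so the coboundary
    condition on \<open>B\<close> is exactly the required relation.\<close>
  then have "two_cocycle T V B" "cohomologous T V B (\<lambda>p x y. 0)"
    by (simp_all add: cohomologous_def two_coboundary_def)
  then have "equivalent_extensions (abelian_trialg V) T
      (Pair 0) (cocycle_trialg T V B) fst (Pair 0) (cocycle_trialg T V (\<lambda>p x y. 0)) fst"
    using assms(1) V two_cocycle_zero by (intro cohomologous_equivalent_extensions)
  \<comment> \<open>The witness is the zero-cocycle extension with its standard inclusion and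
    projection; it is at once central and trivial.\<close>
  then show "\<exists>\<iota> (K :: ('f, 'a \<times> 'v) bihom_trialg) \<pi>.
      central_extension (abelian_trialg V) \<iota> K \<pi> T \<and>
      trivial_extension (abelian_trialg V) \<iota> K \<pi> T \<and>
      equivalent_extensions (abelian_trialg V) T
        (Pair 0) (cocycle_trialg T V B) fst \<iota> K \<pi>"
    using central_extension_cocycle[OF assms(1) V two_cocycle_zero[OF assms(1) V]]
      trivial_extension_zero_cocycle[OF assms(1) V] by blast
qed

end
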